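(* Let $A\in\mathbb{R}^{n\times m}$ have rank $r$ and be $(\mu_1,\mu_2)$-incoherent, let $p\in(0,1]$, and let $Z$ be the wedge matrix of $A$ at rate $p$ (defined in the context). There is an absolute constant $C>0$ such that for any $a>2$, with probability at least $1-O(n^{-a})$, \[ \|Z-AA^\top\|\le C\left(\sqrt{\frac{a\mu_1\mu_2 r^2\log n}{pmn}}+\frac{a\mu_1\mu_2r^2\log n}{pmn}\right)\|A\|^2 . \]
   Context: $\|\cdot\|$ denotes the spectral (operator) norm. A rank-$r$ matrix $A\in\mathbb{R}^{n\times m}$ with compact SVD $A=U\Sigma V^\top$ ($U\in\mathbb{R}^{n\times r},V\in\mathbb{R}^{m\times r}$) is $(\mu_1,\mu_2)$-incoherent if $\max_i\|U_{i,\cdot}\|_2^2\le \mu_1 r/n$ and $\max_j\|V_{j,\cdot}\|_2^2\le\mu_2 r/m$. Wedge sampling: let $\mathcal W=\{(i,\ell,j):1\le i\le j\le n,\ \ell\in[m]\}$; each triple in $\mathcal W$ is included in $\tilde{\mathcal W}$ independently with probability $p$ (for each sampled triple, the entries $A_{i\ell},A_{j\ell}$ are observed). With $E_{ij}=e_ie_j^\top$ and $Z_{i\ell j}=p^{-1}A_{i\ell}A_{j\ell}E_{ij}\mathbf 1\{(i,\ell,j)\in\tilde{\mathcal W}\}$, the wedge matrix is $Z=\sum_{i<j,\ \ell\in[m]}(Z_{i\ell j}+Z_{i\ell j}^\top)+\sum_{i\in[n],\ell\in[m]}Z_{i\ell i}$, which satisfies $\mathbb E Z=AA^\top$. *)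

theory Defs
  imports "HOL-Probability.Probability"
begin

text \<open>Matrices are functions nat => nat => real, used with explicit 0-based
  index bounds (rows < n, columns < m).\<close>

definition spec_norm :: "nat \<Rightarrow> nat \<Rightarrow> (nat \<Rightarrow> nat \<Rightarrow> real) \<Rightarrow> real" where
  "spec_norm n m M =
     Sup ((\<lambda>x. sqrt (\<Sum>i<n. (\<Sum>j<m. M i j * x j)\<^sup>2)) ` {x. (\<Sum>j<m. (x j)\<^sup>2) \<le> 1})"

text \<open>Compact SVD: A = U Sigma V^T with U (n x r), V (m x r) having orthonormal
  columns and Sigma = diag(sigma_1..sigma_r) with positive entries.
  Existence of such a decomposition is equivalent to rank A = r.\<close>
definition compact_svd ::
  "nat \<Rightarrow> nat \<Rightarrow> nat \<Rightarrow> (nat \<Rightarrow> nat \<Rightarrow> real) \<Rightarrow> (nat \<Rightarrow> nat \<Rightarrow> real) \<Rightarrow> (nat \<Rightarrow> real)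
     \<Rightarrow> (nat \<Rightarrow> nat \<Rightarrow> real) \<Rightarrow> bool" where
  "compact_svd n m r A U \<sigma> V \<longleftrightarrow>
     (\<forall>k<r. \<sigma> k > 0) \<and>
     (\<forall>k<r. \<forall>l<r. (\<Sum>i<n. U i k * U i l) = (if k = l then 1 else 0)) \<and>
     (\<forall>k<r. \<forall>l<r. (\<Sum>j<m. V j k * V j l) = (if k = l then 1 else 0)) \<and>
     (\<forall>i<n. \<forall>j<m. A i j = (\<Sum>k<r. U i k * \<sigma> k * V j k))"

definition rank_r_incoherent ::
  "nat \<Rightarrow> nat \<Rightarrow> nat \<Rightarrow> real \<Rightarrow> real \<Rightarrow> (nat \<Rightarrow> nat \<Rightarrow> real) \<Rightarrow> bool" where
  "rank_r_incoherent n m r \<mu>1 \<mu>2 A \<longleftrightarrow>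
     (\<exists>U \<sigma> V. compact_svd n m r A U \<sigma> V \<and>
        (\<forall>i<n. (\<Sum>k<r. (U i k)\<^sup>2) \<le> \<mu>1 * real r / real n) \<and>
        (\<forall>j<m. (\<Sum>k<r. (V j k)\<^sup>2) \<le> \<mu>2 * real r / real m))"

definition wedges :: "nat \<Rightarrow> nat \<Rightarrow> (nat \<times> nat \<times> nat) set" where
  "wedges n m = {(i, l, j). i \<le> j \<and> j < n \<and> l < m}"

definition wedge_sampling :: "nat \<Rightarrow> nat \<Rightarrow> real \<Rightarrow> (nat \<times> nat \<times> nat \<Rightarrow> bool) pmf" where
  "wedge_sampling n m p = Pi_pmf (wedges n m) False (\<lambda>_. bernoulli_pmf p)"

text \<open>Entry (a,b) of Z_{i l j} = p^-1 A_{il} A_{jl} E_{ij} 1{(i,l,j) sampled}.\<close>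
definition wedge_term ::
  "real \<Rightarrow> (nat \<Rightarrow> nat \<Rightarrow> real) \<Rightarrow> (nat \<times> nat \<times> nat \<Rightarrow> bool) \<Rightarrow> nat \<Rightarrow> nat \<Rightarrow> nat \<Rightarrow> nat \<Rightarrow> nat \<Rightarrow> real" where
  "wedge_term p A \<omega> i l j a b =
     (if a = i \<and> b = j \<and> \<omega> (i, l, j) then A i l * A j l / p else 0)"

definition wedge_matrix ::
  "nat \<Rightarrow> nat \<Rightarrow> real \<Rightarrow> (nat \<Rightarrow> nat \<Rightarrow> real) \<Rightarrow> (nat \<times> nat \<times> nat \<Rightarrow> bool) \<Rightarrow> nat \<Rightarrow> nat \<Rightarrow> real" where
  "wedge_matrix n m p A \<omega> a b =
     (\<Sum>i<n. \<Sum>j<n. \<Sum>l<m.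
        (if i < j then wedge_term p A \<omega> i l j a b + wedge_term p A \<omega> i l j b a
         else if i = j then wedge_term p A \<omega> i l i a b else 0))"

end

theory Submission
  imports Defs
begin

text \<open>
  The argument is the moment method. The centred wedge matrix \<open>M\<close> is symmetric with
  entries \<open>M\<^sub>i\<^sub>j = (\<Sum>l. A\<^sub>i\<^sub>l A\<^sub>j\<^sub>l (\<delta>\<^sub>i\<^sub>l\<^sub>j / p - 1))\<close>, so \<open>E tr M\<^sup>N\<close> is a sum over closed
  walks of \<open>N\<close> wedges, and only walks using each wedge at least twice contribute.
  Weighting the first use of a wedge by its variance divided by a scale \<open>\<tau>\<close> and every
  repeated use by \<open>\<tau>\<close>, and noting that from a given vertex there are at most \<open>N\<close> wedges to
  repeat, one gets \<open>E tr M\<^sup>N \<le> n (\<sigma>\<^sup>2 / \<tau> + N \<tau>)\<^sup>N\<close> whenever \<open>\<tau>\<close> dominates the size of the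
  summands. Incoherence bounds the row variance \<open>\<sigma>\<^sup>2\<close> by \<open>T |A|\<^sup>4\<close> and the summands by
  \<open>T |A|\<^sup>2\<close>, where \<open>T = \<mu>\<^sub>1 \<mu>\<^sub>2 r\<^sup>2 / (p m n)\<close>. Markov's inequality with \<open>N\<close> a power of two of
  order \<open>a ln n\<close> concludes.
\<close>

section \<open>Expectations of products over independent coordinates\<close>

lemma finite_set_pmf_Pi_pmf:
  assumes "finite I" "\<And>e. e \<in> I \<Longrightarrow> finite (set_pmf (D e))"
  shows "finite (set_pmf (Pi_pmf I d D))"
  using assms by (auto simp: set_Pi_pmf)

text \<open>Independence of the coordinates; finite supports supply integrability, so the factors
  may take either sign, as centred variables do.\<close>

lemma expectation_prod_Pi_pmf_signed:
  fixes f :: "'e \<Rightarrow> 'b \<Rightarrow> real"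
  assumes fin: "finite I" and D: "\<And>e. e \<in> I \<Longrightarrow> finite (set_pmf (D e))"
  shows "measure_pmf.expectation (Pi_pmf I d D) (\<lambda>\<omega>. \<Prod>e\<in>I. f e (\<omega> e)) =
           (\<Prod>e\<in>I. measure_pmf.expectation (D e) (f e))"
proof -
  let ?M = "Pi_pmf I d D"
  have "prob_space.indep_vars (measure_pmf ?M) (\<lambda>_. count_space UNIV) (\<lambda>e \<omega>. \<omega> e) I"
    by (rule indep_vars_Pi_pmf[OF fin])
  then have ind: "prob_space.indep_vars (measure_pmf ?M) (\<lambda>_. borel) (\<lambda>e \<omega>. f e (\<omega> e)) I"
    by (rule prob_space.indep_vars_compose2[OF prob_space_measure_pmf]) auto
  have "measure_pmf.expectation ?M (\<lambda>\<omega>. \<Prod>e\<in>I. f e (\<omega> e)) =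
          (\<Prod>e\<in>I. measure_pmf.expectation ?M (\<lambda>\<omega>. f e (\<omega> e)))"
    by (rule prob_space.indep_vars_lebesgue_integral[OF prob_space_measure_pmf fin ind])
      (auto intro!: integrable_measure_pmf_finite finite_set_pmf_Pi_pmf fin D)
  also have "\<dots> = (\<Prod>e\<in>I. measure_pmf.expectation (D e) (f e))"
  proof (rule prod.cong[OF refl])
    fix e assume e: "e \<in> I"
    have "measure_pmf.expectation ?M (\<lambda>\<omega>. f e (\<omega> e)) =
            measure_pmf.expectation (map_pmf (\<lambda>\<omega>. \<omega> e) ?M) (f e)"
      by simp
    also have "map_pmf (\<lambda>\<omega>. \<omega> e) ?M = D e"
      using e by (simp add: Pi_pmf_component[OF fin])
    finally show "measure_pmf.expectation ?M (\<lambda>\<omega>. f e (\<omega> e)) = measure_pmf.expectation (D e) (f e)" .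
  qed
  finally show ?thesis .
qed

lemma prod_list_map_eq_prod_count_list:
  fixes f :: "'e \<Rightarrow> 'a::comm_monoid_mult"
  assumes "finite I" "set P \<subseteq> I"
  shows "prod_list (map f P) = (\<Prod>e\<in>I. f e ^ count_list P e)"
  using assms(2)
proof (induction P)
  case (Cons w P)
  have "(\<Prod>e\<in>I. f e ^ count_list (w # P) e) =
          (\<Prod>e\<in>I. (if e = w then f e else 1) * f e ^ count_list P e)"
    by (intro prod.cong) auto
  also have "\<dots> = f w * (\<Prod>e\<in>I. f e ^ count_list P e)"
    using Cons.prems assms(1) by (simp add: prod.distrib)
  finally show ?case using Cons by simp
qed simp

subsection \<open>Powers of a symmetric matrix\<close>

primrec mpow :: "nat \<Rightarrow> (nat \<Rightarrow> nat \<Rightarrow> real) \<Rightarrow> nat \<Rightarrow> nat \<Rightarrow> nat \<Rightarrow> real" where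
  "mpow n M 0 = (\<lambda>i j. if i = j then 1 else 0)"
| "mpow n M (Suc k) = (\<lambda>i j. \<Sum>x<n. M i x * mpow n M k x j)"

lemma mpow_add:
  assumes "i < n"
  shows "mpow n M (k + l) i j = (\<Sum>x<n. mpow n M k i x * mpow n M l x j)"
  using assms
proof (induction k arbitrary: i)
  case 0
  then show ?case by (simp add: if_distrib[of "\<lambda>x. x * _"] cong: if_cong)
next
  case (Suc k)
  have "mpow n M (Suc k + l) i j = (\<Sum>y<n. M i y * (\<Sum>x<n. mpow n M k y x * mpow n M l x j))"
    using Suc.IH by simp
  also have "\<dots> = (\<Sum>x<n. mpow n M (Suc k) i x * mpow n M l x j)"
    by (simp add: sum_distrib_left sum_distrib_right mult.assoc)
      (rule sum.swap)
  finally show ?case .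
qed

lemma mpow_1: "j < n \<Longrightarrow> mpow n M 1 i j = M i j"
  by (simp add: if_distrib[of "\<lambda>x. _ * x"] cong: if_cong)

lemma mpow_sym:
  assumes "\<And>i j. i < n \<Longrightarrow> j < n \<Longrightarrow> M i j = M j i" "i < n" "j < n"
  shows "mpow n M k i j = mpow n M k j i"
  using assms(2,3)
proof (induction k arbitrary: i j)
  case (Suc k)
  have "mpow n M (Suc k) i j = (\<Sum>x<n. mpow n M k j x * mpow n M 1 x i)"
    using Suc assms(1) by (auto simp: mpow_1 simp del: One_nat_def intro!: sum.cong)
  also have "\<dots> = mpow n M (k + 1) j i"
    using Suc.prems by (intro mpow_add[symmetric]) auto
  finally show ?case by simp
qed simp

definition mpow_vec_sqnorm :: "nat \<Rightarrow> (nat \<Rightarrow> nat \<Rightarrow> real) \<Rightarrow> nat \<Rightarrow> (nat \<Rightarrow> real) \<Rightarrow> real" where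
  "mpow_vec_sqnorm n M k x = (\<Sum>i<n. (\<Sum>j<n. mpow n M k i j * x j)\<^sup>2)"

lemma mpow_vec_sqnorm_nonneg: "0 \<le> mpow_vec_sqnorm n M k x"
  by (simp add: mpow_vec_sqnorm_def sum_nonneg)

text \<open>Cauchy--Schwarz for \<open>|M\<^sup>k x|\<^sup>2 = \<langle>x, M\<^sup>2\<^sup>k x\<rangle>\<close>; it replaces the spectral theorem.\<close>

lemma mpow_vec_sqnorm_double:
  assumes sym: "\<And>i j. i < n \<Longrightarrow> j < n \<Longrightarrow> M i j = M j i"
    and x: "(\<Sum>j<n. (x j)\<^sup>2) \<le> 1"
  shows "(mpow_vec_sqnorm n M k x)\<^sup>2 \<le> mpow_vec_sqnorm n M (2 * k) x"
proof -
  have "mpow_vec_sqnorm n M k x =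
          (\<Sum>i<n. \<Sum>j<n. \<Sum>l<n. x j * (mpow n M k j i * mpow n M k i l * x l))"
    unfolding mpow_vec_sqnorm_def power2_eq_square sum_product
    by (intro sum.cong refl) (auto simp: mpow_sym[where k = k, OF sym])
  also have "\<dots> = (\<Sum>j<n. \<Sum>i<n. \<Sum>l<n. x j * (mpow n M k j i * mpow n M k i l * x l))"
    by (rule sum.swap)
  also have "\<dots> = (\<Sum>j<n. \<Sum>l<n. \<Sum>i<n. x j * (mpow n M k j i * mpow n M k i l * x l))"
    by (intro sum.cong refl sum.swap)
  also have "\<dots> = (\<Sum>j<n. x j * (\<Sum>l<n. mpow n M (k + k) j l * x l))"
    by (intro sum.cong refl) (auto simp: mpow_add sum_distrib_left sum_distrib_right)
  finally have "(mpow_vec_sqnorm n M k x)\<^sup>2 =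
      (\<Sum>j<n. x j * (\<Sum>l<n. mpow n M (2 * k) j l * x l))\<^sup>2"
    by (simp add: mult_2)
  also have "\<dots> \<le> (\<Sum>j<n. (x j)\<^sup>2) * mpow_vec_sqnorm n M (2 * k) x"
    unfolding mpow_vec_sqnorm_def by (rule Cauchy_Schwarz_ineq_sum)
  also have "\<dots> \<le> 1 * mpow_vec_sqnorm n M (2 * k) x"
    by (intro mult_right_mono x mpow_vec_sqnorm_nonneg)
  finally show ?thesis by simp
qed

text \<open>Iterated doubling: each Cauchy-Schwarz step squares the left side and doubles the power
  of \<open>M\<close>, which is why the exponents are powers of two.\<close>

lemma mpow_vec_sqnorm_power:
  assumes "\<And>i j. i < n \<Longrightarrow> j < n \<Longrightarrow> M i j = M j i" "(\<Sum>j<n. (x j)\<^sup>2) \<le> 1"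
  shows "mpow_vec_sqnorm n M 1 x ^ (2 ^ s) \<le> mpow_vec_sqnorm n M (2 ^ s) x"
proof (induction s)
  case (Suc s)
  have "mpow_vec_sqnorm n M 1 x ^ (2 ^ Suc s) = (mpow_vec_sqnorm n M 1 x ^ (2 ^ s))\<^sup>2"
    by (simp add: power_mult mult.commute flip: power_mult)
  also have "\<dots> \<le> (mpow_vec_sqnorm n M (2 ^ s) x)\<^sup>2"
    by (intro power_mono Suc zero_le_power mpow_vec_sqnorm_nonneg)
  also have "\<dots> \<le> mpow_vec_sqnorm n M (2 ^ Suc s) x"
    using mpow_vec_sqnorm_double[OF assms] by simp
  finally show ?case .
qed simp

text \<open>By Cauchy-Schwarz in each row, |M^k x|^2 is at most the squared Frobenius norm of M^k,
  which for symmetric \<open>M\<close> is the trace of M^(2k).\<close>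

lemma mpow_vec_sqnorm_le_trace:
  assumes sym: "\<And>i j. i < n \<Longrightarrow> j < n \<Longrightarrow> M i j = M j i"
    and x: "(\<Sum>j<n. (x j)\<^sup>2) \<le> 1"
  shows "mpow_vec_sqnorm n M k x \<le> (\<Sum>i<n. mpow n M (2 * k) i i)"
  unfolding mpow_vec_sqnorm_def
proof (rule sum_mono)
  fix i assume i: "i \<in> {..<n}"
  have "(\<Sum>j<n. mpow n M k i j * x j)\<^sup>2 \<le> (\<Sum>j<n. (mpow n M k i j)\<^sup>2) * (\<Sum>j<n. (x j)\<^sup>2)"
    by (rule Cauchy_Schwarz_ineq_sum)
  also have "\<dots> \<le> (\<Sum>j<n. (mpow n M k i j)\<^sup>2) * 1"
    by (intro mult_left_mono x sum_nonneg) auto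
  also have "\<dots> = (\<Sum>j<n. mpow n M k i j * mpow n M k j i)"
    using i by (auto simp: power2_eq_square intro!: sum.cong mpow_sym[where k = k, OF sym])
  also have "\<dots> = mpow n M (2 * k) i i"
    using i by (simp add: mult_2 mpow_add)
  finally show "(\<Sum>j<n. mpow n M k i j * x j)\<^sup>2 \<le> mpow n M (2 * k) i i" .
qed

text \<open>The case x = 0 of the trace bound, needed later for Markov's inequality.\<close>

lemma trace_mpow_nonneg:
  assumes "\<And>i j. i < n \<Longrightarrow> j < n \<Longrightarrow> M i j = M j i"
  shows "0 \<le> (\<Sum>i<n. mpow n M (2 * k) i i)"
  using mpow_vec_sqnorm_le_trace[where n = n and M = M and x = "\<lambda>_. 0" and k = k, OF assms]
    mpow_vec_sqnorm_nonneg[of n M k "\<lambda>_. 0"] by simp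

text \<open>With y = |M x|, the power y^(2^(s+1)) = (|M x|^2)^(2^s) is at most |M^(2^s) x|^2, hence
  at most the trace. The extra factor 2 in the exponent comes from the squared norm.\<close>

lemma spec_norm_le_of_trace:
  fixes B :: real
  assumes sym: "\<And>i j. i < n \<Longrightarrow> j < n \<Longrightarrow> M i j = M j i"
    and B: "0 \<le> B" and tr: "(\<Sum>i<n. mpow n M (2 ^ Suc s) i i) \<le> B ^ (2 ^ Suc s)"
  shows "spec_norm n n M \<le> B"
  unfolding spec_norm_def
proof (rule cSup_least)
  show "(\<lambda>x. sqrt (\<Sum>i<n. (\<Sum>j<n. M i j * x j)\<^sup>2)) ` {x. (\<Sum>j<n. (x j)\<^sup>2) \<le> 1} \<noteq> {}"
    by (auto intro!: exI[of _ "\<lambda>_. 0"])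
next
  fix y assume "y \<in> (\<lambda>x. sqrt (\<Sum>i<n. (\<Sum>j<n. M i j * x j)\<^sup>2)) ` {x. (\<Sum>j<n. (x j)\<^sup>2) \<le> 1}"
  then obtain x where x: "(\<Sum>j<n. (x j)\<^sup>2) \<le> 1"
    and y: "y = sqrt (\<Sum>i<n. (\<Sum>j<n. M i j * x j)\<^sup>2)" by auto
  have y1: "y = sqrt (mpow_vec_sqnorm n M 1 x)"
    unfolding y mpow_vec_sqnorm_def
    by (intro arg_cong[where f = sqrt] sum.cong arg_cong[where f = power2] refl)
      (simp_all add: mpow_1 del: One_nat_def mpow.simps)
  have y0: "0 \<le> y" unfolding y1 by (simp add: mpow_vec_sqnorm_nonneg del: One_nat_def)
  have "y ^ (2 ^ Suc s) = (y\<^sup>2) ^ (2 ^ s)" by (simp add: power_mult)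
  also have "\<dots> = mpow_vec_sqnorm n M 1 x ^ (2 ^ s)"
    unfolding y1 by (simp add: mpow_vec_sqnorm_nonneg del: One_nat_def)
  also have "\<dots> \<le> mpow_vec_sqnorm n M (2 ^ s) x"
    by (rule mpow_vec_sqnorm_power[OF sym x])
  also have "\<dots> \<le> B ^ (2 ^ Suc s)"
    using mpow_vec_sqnorm_le_trace[where M = M and k = "2 ^ s", OF sym x] tr by simp
  finally show "y \<le> B"
    using B y0 by (metis power_mono_iff zero_less_numeral zero_less_power)
qed

subsection \<open>Expected traces of powers\<close>

text \<open>Bounds the expected product along a walk: a centred variable of size at most \<tau> and
  variance at most \<open>v e\<close> has its moment of order c >= 2 bounded by v e / \<tau> *
  \<tau>^(c - 1). An edge used once has mean zero but gets the same formula, so walks need no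
  classification.\<close>

definition walk_weight :: "('e \<Rightarrow> real) \<Rightarrow> real \<Rightarrow> 'e set \<Rightarrow> 'e list \<Rightarrow> real" where
  "walk_weight v \<tau> I P =
     (\<Prod>e\<in>I. if e \<in> set P then v e / \<tau> * \<tau> ^ (count_list P e - 1) else 1)"

lemma walk_weight_Nil [simp]: "walk_weight v \<tau> I [] = 1"
  by (simp add: walk_weight_def)

lemma walk_weight_nonneg: "(\<And>e. 0 \<le> v e) \<Longrightarrow> 0 < \<tau> \<Longrightarrow> 0 \<le> walk_weight v \<tau> I P"
  unfolding walk_weight_def by (intro prod_nonneg) auto

text \<open>The factor for one more step depends only on whether \<open>w\<close> has been used
  before; this lets walks be summed one step at a time.\<close>

lemma walk_weight_Cons:
  assumes "finite I" "w \<in> I"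
  shows "walk_weight v \<tau> I (w # P) = (if w \<in> set P then \<tau> else v w / \<tau>) * walk_weight v \<tau> I P"
proof -
  have pos: "count_list P w > 0" if "w \<in> set P"
    using that by (metis count_list_0_iff gr0I)
  have "walk_weight v \<tau> I (w # P) =
     (\<Prod>e\<in>I. (if e = w then (if w \<in> set P then \<tau> else v w / \<tau>) else 1) *
        (if e \<in> set P then v e / \<tau> * \<tau> ^ (count_list P e - 1) else 1))"
    unfolding walk_weight_def
  proof (intro prod.cong refl)
    fix e assume "e \<in> I"
    show "(if e \<in> set (w # P) then v e / \<tau> * \<tau> ^ (count_list (w # P) e - 1) else 1) =
       (if e = w then (if w \<in> set P then \<tau> else v w / \<tau>) else 1) *
        (if e \<in> set P then v e / \<tau> * \<tau> ^ (count_list P e - 1) else 1)"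
    \<comment> \<open>\<open>count_list P e - 1\<close> is truncated subtraction, so a repeated edge
      needs its earlier count written as a successor.\<close>
    proof (cases "e = w \<and> w \<in> set P")
      case True
      then obtain c where "count_list P w = Suc c" using pos gr0_conv_Suc by blast
      with True show ?thesis by simp
    qed (auto simp: count_list_0_iff)
  qed
  also have "\<dots> = (if w \<in> set P then \<tau> else v w / \<tau>) * walk_weight v \<tau> I P"
    using assms by (simp add: prod.distrib walk_weight_def)
  finally show ?thesis .
qed

text \<open>Expanding the power as a sum over walks: the sum over unused edges contributes
  at most \<open>\<sigma>2 / \<tau>\<close> per step, and an edge already used is one of at most \<open>N\<close>, each
  contributing \<open>\<tau>\<close>. The list \<open>P\<close> records the edges used so far. For \<open>q = 0\<close> the moment
  hypothesis is met because the variables in question are centred.\<close>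

lemma expectation_mpow_le:
  fixes y :: "'e \<Rightarrow> 'b \<Rightarrow> real" and w :: "nat \<Rightarrow> nat \<Rightarrow> nat \<Rightarrow> 'e"
  assumes fin: "finite I" and D: "\<And>e. e \<in> I \<Longrightarrow> finite (set_pmf (D e))"
    and w: "\<And>i l x. i < n \<Longrightarrow> l < m \<Longrightarrow> x < n \<Longrightarrow> w i l x \<in> I"
    and inj: "\<And>i. i < n \<Longrightarrow> inj_on (\<lambda>(x, l). w i l x) ({..<n} \<times> {..<m})"
    and v0: "\<And>e. 0 \<le> v e" and \<tau>: "0 < \<tau>"
    and \<sigma>2: "\<And>i. i < n \<Longrightarrow> (\<Sum>x<n. \<Sum>l<m. v (w i l x)) \<le> \<sigma>2"
    and mom: "\<And>e q. e \<in> I \<Longrightarrow>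
       \<bar>measure_pmf.expectation (D e) (\<lambda>b. y e b ^ Suc q)\<bar> \<le> v e / \<tau> * \<tau> ^ q"
    and "i < n" "j < n" "set P \<subseteq> I" "length P + k \<le> N"
  shows "\<bar>measure_pmf.expectation (Pi_pmf I d D)
            (\<lambda>\<omega>. (\<Prod>e\<leftarrow>P. y e (\<omega> e)) * mpow n (\<lambda>i x. \<Sum>l<m. y (w i l x) (\<omega> (w i l x))) k i j)\<bar>
          \<le> walk_weight v \<tau> I P * (\<sigma>2 / \<tau> + real N * \<tau>) ^ k"
  using assms(9-12)
proof (induction k arbitrary: i P)
  case 0
  let ?M = "Pi_pmf I d D"
  have "\<bar>measure_pmf.expectation ?M (\<lambda>\<omega>. \<Prod>e\<leftarrow>P. y e (\<omega> e))\<bar> \<le> walk_weight v \<tau> I P"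
  proof -
    have "measure_pmf.expectation ?M (\<lambda>\<omega>. \<Prod>e\<leftarrow>P. y e (\<omega> e)) =
        measure_pmf.expectation ?M (\<lambda>\<omega>. \<Prod>e\<in>I. y e (\<omega> e) ^ count_list P e)"
      by (simp only: prod_list_map_eq_prod_count_list[OF fin 0(3)])
    also have "\<dots> = (\<Prod>e\<in>I. measure_pmf.expectation (D e) (\<lambda>b. y e b ^ count_list P e))"
      by (rule expectation_prod_Pi_pmf_signed[OF fin D])
    also have "\<bar>\<dots>\<bar> \<le> walk_weight v \<tau> I P"
      unfolding walk_weight_def abs_prod
    proof (intro prod_mono conjI)
      fix e assume e: "e \<in> I"
      show "\<bar>measure_pmf.expectation (D e) (\<lambda>b. y e b ^ count_list P e)\<bar>
          \<le> (if e \<in> set P then v e / \<tau> * \<tau> ^ (count_list P e - 1) else 1)"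
      proof (cases "count_list P e")
        case 0
        then show ?thesis by (simp add: count_list_0_iff)
      next
        case (Suc c)
        then have "e \<in> set P" by (metis count_list_0_iff nat.distinct(1))
        then show ?thesis using mom[OF e, of c] Suc by simp
      qed
    qed auto
    finally show ?thesis .
  qed
  moreover have "0 \<le> walk_weight v \<tau> I P" by (rule walk_weight_nonneg[OF v0 \<tau>])
  ultimately show ?case by (cases "i = j") simp_all
next
  case (Suc k)
  let ?M = "Pi_pmf I d D"
  let ?X = "\<lambda>\<omega> i x. \<Sum>l<m. y (w i l x) (\<omega> (w i l x))"
  let ?E = "\<lambda>P i. measure_pmf.expectation ?M (\<lambda>\<omega>. (\<Prod>e\<leftarrow>P. y e (\<omega> e)) * mpow n (?X \<omega>) k i j)"
  define Q where "Q = \<sigma>2 / \<tau> + real N * \<tau>"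
  define \<Phi> where "\<Phi> = walk_weight v \<tau> I P"
  have \<sigma>0: "0 \<le> \<sigma>2"
    by (rule order_trans[OF _ \<sigma>2[OF Suc.prems(1)]]) (auto intro!: sum_nonneg v0)
  have Q0: "0 \<le> Q" unfolding Q_def using \<sigma>0 \<tau> by simp
  have \<Phi>0: "0 \<le> \<Phi>" unfolding \<Phi>_def by (rule walk_weight_nonneg[OF v0 \<tau>])
  have int: "integrable ?M f" for f :: "_ \<Rightarrow> real"
    by (intro integrable_measure_pmf_finite finite_set_pmf_Pi_pmf fin D)
  \<comment> \<open>Opening the first factor of the matrix power moves one edge into the recorded
    list: a step from \<open>i\<close> to \<open>x\<close> through \<open>l\<close> uses
    \<open>w i l x\<close>.\<close>
  have "measure_pmf.expectation ?M (\<lambda>\<omega>. (\<Prod>e\<leftarrow>P. y e (\<omega> e)) * mpow n (?X \<omega>) (Suc k) i j)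
      = measure_pmf.expectation ?M (\<lambda>\<omega>. \<Sum>x<n. \<Sum>l<m.
           (\<Prod>e\<leftarrow>(w i l x # P). y e (\<omega> e)) * mpow n (?X \<omega>) k x j)"
    by (intro Bochner_Integration.integral_cong)
      (auto simp: sum_distrib_left sum_distrib_right algebra_simps)
  also have "\<dots> = (\<Sum>x<n. \<Sum>l<m. ?E (w i l x # P) x)"
    by (simp only: Bochner_Integration.integral_sum[OF int])
  finally have step: "measure_pmf.expectation ?M (\<lambda>\<omega>. (\<Prod>e\<leftarrow>P. y e (\<omega> e)) * mpow n (?X \<omega>) (Suc k) i j)
      = (\<Sum>x<n. \<Sum>l<m. ?E (w i l x # P) x)" .
  have "\<bar>\<Sum>x<n. \<Sum>l<m. ?E (w i l x # P) x\<bar> \<le> (\<Sum>x<n. \<Sum>l<m. \<bar>?E (w i l x # P) x\<bar>)"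
    by (intro order_trans[OF sum_abs] sum_mono sum_abs)
  also have "\<dots> \<le> (\<Sum>x<n. \<Sum>l<m. walk_weight v \<tau> I (w i l x # P) * Q ^ k)"
    unfolding Q_def
  proof (intro sum_mono)
    fix x l assume xl: "x \<in> {..<n}" "l \<in> {..<m}"
    show "\<bar>?E (w i l x # P) x\<bar> \<le> walk_weight v \<tau> I (w i l x # P) * (\<sigma>2 / \<tau> + real N * \<tau>) ^ k"
      by (rule Suc.IH[of x "w i l x # P"]) (use xl Suc.prems w[of i l x] in simp_all)
  qed
  \<comment> \<open>Replacing the case split by the sum of both contributions separates repeated
    edges from the variance sum, which may then run over all edges.\<close>
  also have "\<dots> \<le> (\<Sum>x<n. \<Sum>l<m. ((if w i l x \<in> set P then \<tau> else 0) + v (w i l x) / \<tau>) * (\<Phi> * Q ^ k))"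
  proof (intro sum_mono)
    fix x l assume xl: "x \<in> {..<n}" "l \<in> {..<m}"
    have "walk_weight v \<tau> I (w i l x # P) = (if w i l x \<in> set P then \<tau> else v (w i l x) / \<tau>) * \<Phi>"
      unfolding \<Phi>_def by (rule walk_weight_Cons[OF fin]) (use xl Suc.prems w[of i l x] in simp)
    also have "\<dots> \<le> ((if w i l x \<in> set P then \<tau> else 0) + v (w i l x) / \<tau>) * \<Phi>"
      using v0[of "w i l x"] \<tau> by (intro mult_right_mono \<Phi>0) auto
    finally show "walk_weight v \<tau> I (w i l x # P) * Q ^ k
        \<le> ((if w i l x \<in> set P then \<tau> else 0) + v (w i l x) / \<tau>) * (\<Phi> * Q ^ k)"
      using Q0 by (simp add: mult_right_mono flip: mult.assoc)
  qed
  also have "\<dots> = ((\<Sum>x<n. \<Sum>l<m. if w i l x \<in> set P then \<tau> else 0)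
                   + (\<Sum>x<n. \<Sum>l<m. v (w i l x)) / \<tau>) * (\<Phi> * Q ^ k)"
    by (simp only: sum.distrib sum_distrib_right[symmetric] sum_divide_distrib)
  also have "\<dots> \<le> Q * (\<Phi> * Q ^ k)"
  proof (intro mult_right_mono)
    let ?g = "\<lambda>(x, l). w i l x"
    let ?S = "{z \<in> {..<n} \<times> {..<m}. ?g z \<in> set P}"
    have "(\<Sum>x<n. \<Sum>l<m. if w i l x \<in> set P then \<tau> else 0) =
        (\<Sum>z\<in>{..<n} \<times> {..<m}. if ?g z \<in> set P then \<tau> else 0)"
      by (subst sum.cartesian_product) (simp add: case_prod_unfold)
    also have "\<dots> = (\<Sum>z\<in>?S. \<tau>)"
      by (subst sum.inter_filter) auto
    finally have sum_eq: "(\<Sum>x<n. \<Sum>l<m. if w i l x \<in> set P then \<tau> else 0) = real (card ?S) * \<tau>" by simp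
    \<comment> \<open>From \<open>i\<close>, each used edge is hit by at most one pair (x, l), and
      \<open>P\<close> has at most \<open>N\<close> edges.\<close>
    have "card ?S \<le> card (set P)"
      by (rule card_inj_on_le[of ?g])
        (use inj[OF Suc.prems(1)] in \<open>auto intro: inj_on_subset\<close>)
    also have "card (set P) \<le> N" using card_length[of P] Suc.prems(4) by simp
    finally have "(\<Sum>x<n. \<Sum>l<m. if w i l x \<in> set P then \<tau> else 0) \<le> real N * \<tau>"
      unfolding sum_eq using \<tau> by (intro mult_right_mono) auto
    moreover have "(\<Sum>x<n. \<Sum>l<m. v (w i l x)) / \<tau> \<le> \<sigma>2 / \<tau>"
      using \<sigma>2[OF Suc.prems(1)] \<tau> by (simp add: divide_right_mono)
    ultimately show "(\<Sum>x<n. \<Sum>l<m. if w i l x \<in> set P then \<tau> else 0)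
                   + (\<Sum>x<n. \<Sum>l<m. v (w i l x)) / \<tau> \<le> Q"
      unfolding Q_def by simp
  qed (use \<Phi>0 Q0 in auto)
  finally have "\<bar>\<Sum>x<n. \<Sum>l<m. ?E (w i l x # P) x\<bar> \<le> \<Phi> * Q ^ Suc k"
    by (simp only: power_Suc mult.left_commute)
  then show ?case unfolding step Q_def \<Phi>_def .
qed

subsection \<open>The wedge matrix\<close>

text \<open>For \<open>q = 0\<close> the mean is zero. Otherwise two factors are kept for the
  variance c^2 (1 - p) / p, at most c^2 / p, and the other \<open>q - 1\<close> are each bounded by
  |c| / p and so by \<tau>.\<close>

lemma centred_bernoulli_moment:
  fixes c p \<tau> :: real
  assumes p: "0 < p" "p \<le> 1" and \<tau>: "0 < \<tau>" "\<bar>c\<bar> / p \<le> \<tau>"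
  shows "\<bar>measure_pmf.expectation (bernoulli_pmf p) (\<lambda>b. (c * (of_bool b / p - 1)) ^ Suc q)\<bar>
           \<le> c\<^sup>2 / p / \<tau> * \<tau> ^ q"
proof (cases q)
  case 0
  then show ?thesis using assms by (simp add: field_simps)
next
  case (Suc k)
  define y where "y b = c * (of_bool b / p - 1)" for b
  have y\<tau>: "\<bar>y b\<bar> \<le> \<tau>" for b
  proof -
    have "\<bar>of_bool b / p - 1\<bar> \<le> 1 / p" using p by (cases b) (auto simp: field_simps)
    then have "\<bar>y b\<bar> \<le> \<bar>c\<bar> * (1 / p)" unfolding y_def abs_mult by (intro mult_left_mono) auto
    then show ?thesis using \<tau> by simp
  qed
  have pw: "\<bar>y b ^ Suc q\<bar> \<le> \<tau> ^ k * (y b)\<^sup>2" for b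
  proof -
    have "\<bar>y b ^ Suc q\<bar> = \<bar>y b\<bar> ^ k * (y b)\<^sup>2"
      by (simp add: Suc power_abs abs_mult power2_eq_square)
    also have "\<dots> \<le> \<tau> ^ k * (y b)\<^sup>2"
      by (intro mult_right_mono power_mono y\<tau>) auto
    finally show ?thesis .
  qed
  have "\<bar>measure_pmf.expectation (bernoulli_pmf p) (\<lambda>b. y b ^ Suc q)\<bar> =
      \<bar>y True ^ Suc q * p + y False ^ Suc q * (1 - p)\<bar>"
    using p by simp
  also have "\<dots> \<le> \<bar>y True ^ Suc q\<bar> * p + \<bar>y False ^ Suc q\<bar> * (1 - p)"
    using p abs_triangle_ineq[of "y True ^ Suc q * p" "y False ^ Suc q * (1 - p)"]
    by (simp only: abs_mult[of _ p] abs_mult[of _ "1 - p"] abs_of_nonneg diff_ge_0_iff_ge less_imp_le)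
  also have "\<dots> \<le> (\<tau> ^ k * (y True)\<^sup>2) * p + (\<tau> ^ k * (y False)\<^sup>2) * (1 - p)"
    using p by (intro add_mono mult_right_mono pw) auto
  also have "\<dots> = \<tau> ^ k * (c\<^sup>2 * ((1 - p) / p))"
    using p by (simp add: y_def field_simps power2_eq_square)
  also have "\<dots> \<le> \<tau> ^ k * (c\<^sup>2 * (1 / p))"
    using p \<tau> by (intro mult_left_mono divide_right_mono) auto
  also have "\<dots> = c\<^sup>2 / p / \<tau> * \<tau> ^ q" using \<tau> by (simp add: Suc)
  finally show ?thesis unfolding y_def .
qed

lemma finite_wedges: "finite (wedges n m)"
  by (rule finite_subset[of _ "{..<n} \<times> {..<m} \<times> {..<n}"]) (auto simp: wedges_def)

text \<open>Only wedges with ends \<open>min a b\<close> and \<open>max a b\<close> reach the entry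
  (a, b): directly if a < b, through the transpose if a > b, and once if a = b. The nested
  conditionals suit \<open>sum.delta\<close>.\<close>

lemma wedge_matrix_summand:
  "(if i < j then wedge_term p A \<omega> i l j a b + wedge_term p A \<omega> i l j b a
    else if i = j then wedge_term p A \<omega> i l i a b else 0) =
   (if j = max a b then
      if i = min a b then if \<omega> (min a b, l, max a b) then A a l * A b l / p else 0 else 0
    else 0)"
proof (cases a b rule: linorder_cases)
  case less
  then have "max a b = b" "min a b = a" by simp_all
  with less show ?thesis by (auto simp: wedge_term_def)
next
  case equal
  then show ?thesis by (auto simp: wedge_term_def)
next
  case greater
  then have "max a b = a" "min a b = b" by simp_all
  with greater show ?thesis by (auto simp: wedge_term_def)
qed

lemma wedge_matrix_eq:
  assumes "a < n" "b < n"
  shows "wedge_matrix n m p A \<omega> a b =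
    (\<Sum>l<m. if \<omega> (min a b, l, max a b) then A a l * A b l / p else 0)"
proof -
  let ?g = "\<lambda>l. if \<omega> (min a b, l, max a b) then A a l * A b l / p else 0"
  have lt: "max a b < n" "min a b < n" using assms by auto
  have pull: "(\<Sum>l<m. if P then if R then ?g l else 0 else 0) =
      (if P then if R then \<Sum>l<m. ?g l else 0 else 0)" for P R
    by (cases P; cases R) (simp_all only: if_True if_False sum.neutral_const)
  show ?thesis
    unfolding wedge_matrix_def wedge_matrix_summand pull
    using lt by (simp only: sum.delta finite_lessThan lessThan_iff if_True)
qed

text \<open>The trace of the N-th power has mean at most n Q^N, so Markov's inequality at level B^N
  with B >= e Q leaves failure probability n e^(-N). \<open>N\<close> is a power of two for the norm
  bound by traces, and even so that the trace is nonnegative.\<close>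

lemma wedge_matrix_concentration:
  fixes A :: "nat \<Rightarrow> nat \<Rightarrow> real" and p \<tau> \<sigma>2 :: real
  assumes p: "0 < p" "p \<le> 1" and \<tau>: "0 < \<tau>"
    and L: "\<And>i j l. i < n \<Longrightarrow> j < n \<Longrightarrow> l < m \<Longrightarrow> \<bar>A i l * A j l\<bar> / p \<le> \<tau>"
    and \<sigma>2: "\<And>i. i < n \<Longrightarrow> (\<Sum>x<n. \<Sum>l<m. (A i l * A x l)\<^sup>2 / p) \<le> \<sigma>2" "0 \<le> \<sigma>2"
    and N: "N = 2 ^ Suc s"
    and B: "exp 1 * (\<sigma>2 / \<tau> + real N * \<tau>) \<le> B"
  shows "1 - real n * exp (- real N) \<le> measure_pmf.prob (wedge_sampling n m p)
     {\<omega>. spec_norm n n (\<lambda>i j. wedge_matrix n m p A \<omega> i j - (\<Sum>l<m. A i l * A j l)) \<le> B}"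
proof -
  \<comment> \<open>Ordering the end points makes the steps from \<open>i\<close> to
    \<open>x\<close> and from \<open>x\<close> to \<open>i\<close> use the same variable, so the
    walk matrix is symmetric.\<close>
  define w :: "nat \<Rightarrow> nat \<Rightarrow> nat \<Rightarrow> nat \<times> nat \<times> nat" where "w i l x = (min i x, l, max i x)" for i l x
  define c where "c = (\<lambda>(i, l, j). A i l * A j l)"
  define v where "v e = (c e)\<^sup>2 / p" for e
  define y where "y e b = c e * (of_bool b / p - 1)" for e b
  \<comment> \<open>\<open>X\<close> is the matrix of the walk expansion and \<open>Y\<close> the
    centred wedge matrix; they are identified on indices below \<open>n\<close>, where their powers
    agree too.\<close>
  define X where "X \<omega> i x = (\<Sum>l<m. y (w i l x) (\<omega> (w i l x)))" for \<omega> i x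
  define Y where "Y \<omega> i j = wedge_matrix n m p A \<omega> i j - (\<Sum>l<m. A i l * A j l)" for \<omega> i j
  define Q where "Q = \<sigma>2 / \<tau> + real N * \<tau>"
  let ?M = "wedge_sampling n m p"
  have N0: "0 < N" unfolding N by simp
  have Q0: "0 < Q" unfolding Q_def using \<sigma>2(2) \<tau> N0 by (intro add_nonneg_pos) auto
  have B0: "0 < B" using B Q0 unfolding Q_def by (smt (verit) exp_gt_zero mult_pos_pos)
  have cw: "c (w i l x) = A i l * A x l" for i l x
    by (simp add: c_def w_def min_def max_def)
  have XY: "X \<omega> i j = Y \<omega> i j" if "i < n" "j < n" for \<omega> i j
    unfolding Y_def wedge_matrix_eq[OF that] X_def y_def cw sum_subtractf[symmetric]
    by (intro sum.cong refl) (auto simp: w_def algebra_simps)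
  have XYpow: "mpow n (X \<omega>) k i j = mpow n (Y \<omega>) k i j" if "i < n" "j < n" for \<omega> k i j
    using that by (induction k arbitrary: i) (auto simp: XY intro!: sum.cong)
  have symX: "X \<omega> i j = X \<omega> j i" for \<omega> i j
    by (simp add: X_def w_def min.commute max.commute)
  have symY: "Y \<omega> i j = Y \<omega> j i" if "i < n" "j < n" for \<omega> i j
    using XY symX that by metis
  have fin: "finite (set_pmf ?M)"
    unfolding wedge_sampling_def by (intro finite_set_pmf_Pi_pmf finite_wedges) auto
  have int: "integrable ?M f" for f :: "_ \<Rightarrow> real"
    by (rule integrable_measure_pmf_finite[OF fin])
  define R where "R \<omega> = (\<Sum>i<n. mpow n (Y \<omega>) N i i)" for \<omega>
  have R0: "0 \<le> R \<omega>" for \<omega>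
    unfolding R_def N power_Suc by (rule trace_mpow_nonneg) (rule symY)
  have diag: "measure_pmf.expectation ?M (\<lambda>\<omega>. mpow n (Y \<omega>) N i i) \<le> Q ^ N" if i: "i < n" for i
  proof -
    have "\<bar>measure_pmf.expectation (Pi_pmf (wedges n m) False (\<lambda>_. bernoulli_pmf p))
            (\<lambda>\<omega>. (\<Prod>e\<leftarrow>[]. y e (\<omega> e)) * mpow n (\<lambda>i x. \<Sum>l<m. y (w i l x) (\<omega> (w i l x))) N i i)\<bar>
          \<le> walk_weight v \<tau> (wedges n m) [] * (\<sigma>2 / \<tau> + real N * \<tau>) ^ N"
    proof (rule expectation_mpow_le)
      show "w i l x \<in> wedges n m" if "i < n" "l < m" "x < n" for i l x
        using that by (auto simp: w_def wedges_def)
      show "inj_on (\<lambda>(x, l). w i l x) ({..<n} \<times> {..<m})" for i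
        by (auto simp: inj_on_def w_def min_def max_def split: if_splits)
      show "0 \<le> v e" for e using p by (simp add: v_def)
      show "(\<Sum>x<n. \<Sum>l<m. v (w i l x)) \<le> \<sigma>2" if "i < n" for i
        using \<sigma>2(1)[OF that] by (simp add: v_def cw)
      show "\<bar>measure_pmf.expectation (bernoulli_pmf p) (\<lambda>b. y e b ^ Suc q)\<bar> \<le> v e / \<tau> * \<tau> ^ q"
        if "e \<in> wedges n m" for e q
        unfolding y_def v_def
        by (rule centred_bernoulli_moment[OF p \<tau>]) (use that in \<open>auto simp: wedges_def c_def intro: L\<close>)
    qed (use i \<tau> in \<open>auto simp: finite_wedges\<close>)
    then have "\<bar>measure_pmf.expectation ?M (\<lambda>\<omega>. mpow n (X \<omega>) N i i)\<bar> \<le> Q ^ N"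
      by (simp add: wedge_sampling_def Q_def X_def[abs_def])
    then show ?thesis using XYpow[OF i i] by simp
  qed
  have "measure_pmf.expectation ?M R = (\<Sum>i<n. measure_pmf.expectation ?M (\<lambda>\<omega>. mpow n (Y \<omega>) N i i))"
    unfolding R_def by (rule Bochner_Integration.integral_sum[OF int])
  also have "\<dots> \<le> (\<Sum>i<n. Q ^ N)" by (intro sum_mono diag) auto
  finally have ER: "measure_pmf.expectation ?M R \<le> real n * Q ^ N" by simp
  have "measure_pmf.prob ?M {\<omega>. B ^ N \<le> R \<omega>} \<le> measure_pmf.expectation ?M R / B ^ N"
    using integral_Markov_inequality_measure[OF int[of R], of "{}" "B ^ N"] R0 B0 by simp
  also have "\<dots> \<le> real n * Q ^ N / (exp 1 * Q) ^ N"
    using ER B Q0 unfolding Q_def[symmetric]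
    by (intro frac_le power_mono) auto
  also have "\<dots> = real n * exp (- real N)"
    using Q0 by (simp add: power_mult_distrib exp_minus field_simps flip: exp_of_nat_mult)
  finally have tail: "measure_pmf.prob ?M {\<omega>. B ^ N \<le> R \<omega>} \<le> real n * exp (- real N)" .
  have "1 - measure_pmf.prob ?M {\<omega>. B ^ N \<le> R \<omega>} = measure_pmf.prob ?M (UNIV - {\<omega>. B ^ N \<le> R \<omega>})"
    using measure_pmf.prob_compl[of "{\<omega>. B ^ N \<le> R \<omega>}" ?M] by simp
  also have "\<dots> \<le> measure_pmf.prob ?M {\<omega>. spec_norm n n (Y \<omega>) \<le> B}"
  proof (rule measure_pmf.finite_measure_mono)
    show "UNIV - {\<omega>. B ^ N \<le> R \<omega>} \<subseteq> {\<omega>. spec_norm n n (Y \<omega>) \<le> B}"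
    proof
      fix \<omega> assume "\<omega> \<in> UNIV - {\<omega>. B ^ N \<le> R \<omega>}"
      then have "(\<Sum>i<n. mpow n (Y \<omega>) (2 ^ Suc s) i i) \<le> B ^ (2 ^ Suc s)"
        unfolding R_def N by simp
      then have "spec_norm n n (Y \<omega>) \<le> B"
        using B0 symY by (intro spec_norm_le_of_trace[where M = "Y \<omega>"]) auto
      then show "\<omega> \<in> {\<omega>. spec_norm n n (Y \<omega>) \<le> B}" by simp
    qed
  qed simp
  finally show ?thesis using tail unfolding Y_def[abs_def] by simp
qed

subsection \<open>Incoherent matrices\<close>

text \<open>A matrix with orthonormal columns is an isometry: on expanding the square the cross
  terms vanish.\<close>

lemma sum_square_orthonormal:
  fixes U :: "nat \<Rightarrow> nat \<Rightarrow> real"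
  assumes "\<And>k l. k < r \<Longrightarrow> l < r \<Longrightarrow> (\<Sum>i<n. U i k * U i l) = (if k = l then 1 else 0)"
  shows "(\<Sum>i<n. (\<Sum>k<r. U i k * c k)\<^sup>2) = (\<Sum>k<r. (c k)\<^sup>2)"
proof -
  have "(\<Sum>i<n. (\<Sum>k<r. U i k * c k)\<^sup>2) = (\<Sum>i<n. \<Sum>k<r. \<Sum>l<r. c k * c l * (U i k * U i l))"
    by (simp add: power2_eq_square sum_product algebra_simps)
  also have "\<dots> = (\<Sum>k<r. \<Sum>i<n. \<Sum>l<r. c k * c l * (U i k * U i l))"
    by (rule sum.swap)
  also have "\<dots> = (\<Sum>k<r. \<Sum>l<r. \<Sum>i<n. c k * c l * (U i k * U i l))"
    by (intro sum.cong refl sum.swap)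
  also have "\<dots> = (\<Sum>k<r. \<Sum>l<r. c k * c l * (if k = l then 1 else 0))"
    using assms by (simp flip: sum_distrib_left)
  also have "\<dots> = (\<Sum>k<r. (c k)\<^sup>2)"
    by (intro sum.cong refl) (simp add: if_distrib[of "\<lambda>x. _ * x"] power2_eq_square cong: if_cong)
  finally show ?thesis .
qed

text \<open>The supremum is over a bounded set: Cauchy-Schwarz in each row bounds it by the
  Frobenius norm.\<close>

lemma spec_norm_ge:
  fixes x :: "nat \<Rightarrow> real"
  assumes "(\<Sum>j<m. (x j)\<^sup>2) \<le> 1"
  shows "sqrt (\<Sum>i<n. (\<Sum>j<m. M i j * x j)\<^sup>2) \<le> spec_norm n m M"
  unfolding spec_norm_def
proof (rule cSUP_upper)
  show "bdd_above ((\<lambda>x. sqrt (\<Sum>i<n. (\<Sum>j<m. M i j * x j)\<^sup>2)) ` {x. (\<Sum>j<m. (x j)\<^sup>2) \<le> 1})"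
  proof (rule bdd_aboveI2)
    fix x :: "nat \<Rightarrow> real" assume "x \<in> {x. (\<Sum>j<m. (x j)\<^sup>2) \<le> 1}"
    then have x: "(\<Sum>j<m. (x j)\<^sup>2) \<le> 1" by simp
    have "(\<Sum>j<m. M i j * x j)\<^sup>2 \<le> (\<Sum>j<m. (M i j)\<^sup>2)" for i
    proof -
      have "(\<Sum>j<m. M i j * x j)\<^sup>2 \<le> (\<Sum>j<m. (M i j)\<^sup>2) * (\<Sum>j<m. (x j)\<^sup>2)"
        by (rule Cauchy_Schwarz_ineq_sum)
      also have "\<dots> \<le> (\<Sum>j<m. (M i j)\<^sup>2) * 1"
        by (intro mult_left_mono x sum_nonneg) auto
      finally show ?thesis by simp
    qed
    then show "sqrt (\<Sum>i<n. (\<Sum>j<m. M i j * x j)\<^sup>2) \<le> sqrt (\<Sum>i<n. \<Sum>j<m. (M i j)\<^sup>2)"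
      by (intro real_sqrt_le_mono sum_mono)
  qed
qed (use assms in simp)

text \<open>The k-th column of \<open>V\<close> serves as test vector, since \<open>A\<close> maps
  it to \<open>\<sigma> k\<close> times the k-th column of \<open>U\<close>.\<close>

lemma singular_value_le_spec_norm:
  assumes svd: "compact_svd n m r A U \<sigma> V" and k: "k < r"
  shows "\<sigma> k \<le> spec_norm n m A"
proof -
  have V: "(\<Sum>j<m. V j k' * V j l) = (if k' = l then 1 else 0)" if "k' < r" "l < r" for k' l
    using svd that by (simp add: compact_svd_def)
  have U: "(\<Sum>i<n. U i k * U i k) = 1" using svd k by (simp add: compact_svd_def)
  have "(\<Sum>j<m. A i j * V j k) = U i k * \<sigma> k" if "i < n" for i
  proof -
    have "(\<Sum>j<m. A i j * V j k) = (\<Sum>j<m. \<Sum>k'<r. U i k' * \<sigma> k' * (V j k' * V j k))"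
      using svd that by (simp add: compact_svd_def sum_distrib_right mult.assoc)
    also have "\<dots> = (\<Sum>k'<r. U i k' * \<sigma> k' * (\<Sum>j<m. V j k' * V j k))"
      by (subst sum.swap) (simp add: sum_distrib_left)
    also have "\<dots> = (\<Sum>k'<r. U i k' * \<sigma> k' * (if k' = k then 1 else 0))"
      using V k by simp
    also have "\<dots> = U i k * \<sigma> k"
      using k by (simp add: if_distrib[of "\<lambda>x. _ * x"] cong: if_cong)
    finally show ?thesis .
  qed
  then have "(\<Sum>i<n. (\<Sum>j<m. A i j * V j k)\<^sup>2) = (\<Sum>i<n. U i k * U i k) * (\<sigma> k)\<^sup>2"
    by (simp add: power2_eq_square sum_distrib_right sum_distrib_left mult_ac)
  moreover have "\<sigma> k > 0" using svd k by (simp add: compact_svd_def)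
  ultimately have "sqrt (\<Sum>i<n. (\<Sum>j<m. A i j * V j k)\<^sup>2) = \<sigma> k" using U by simp
  moreover have "(\<Sum>j<m. (V j k)\<^sup>2) \<le> 1" using V[OF k k] by (simp add: power2_eq_square)
  ultimately show ?thesis using spec_norm_ge[where x = "\<lambda>j. V j k" and M = A and n = n and m = m] by simp
qed

text \<open>Column \<open>l\<close> of \<open>A\<close> is \<open>U\<close> applied to the vector
  with entries \<open>\<sigma> k * V l k\<close>; \<open>U\<close> is an isometry and the singular
  values are at most |A|. Rows follow with \<open>U\<close> and \<open>V\<close> exchanged, entries
  by Cauchy-Schwarz.\<close>

lemma incoherence_bounds:
  assumes svd: "compact_svd n m r A U \<sigma> V"
    and U: "\<And>i. i < n \<Longrightarrow> (\<Sum>k<r. (U i k)\<^sup>2) \<le> \<alpha>"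
    and V: "\<And>j. j < m \<Longrightarrow> (\<Sum>k<r. (V j k)\<^sup>2) \<le> \<beta>"
  defines "S \<equiv> (spec_norm n m A)\<^sup>2"
  shows "\<And>l. l < m \<Longrightarrow> (\<Sum>i<n. (A i l)\<^sup>2) \<le> S * \<beta>"
    and "\<And>i. i < n \<Longrightarrow> (\<Sum>l<m. (A i l)\<^sup>2) \<le> S * \<alpha>"
    and "\<And>i l. i < n \<Longrightarrow> l < m \<Longrightarrow> (A i l)\<^sup>2 \<le> S * (\<alpha> * \<beta>)"
proof -
  have s: "(\<sigma> k)\<^sup>2 \<le> S" if "k < r" for k
    unfolding S_def using singular_value_le_spec_norm[OF svd that] svd that
    by (intro power_mono) (auto simp: compact_svd_def intro: less_imp_le)
  have S0: "0 \<le> S" by (simp add: S_def)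
  have A: "A i j = (\<Sum>k<r. U i k * \<sigma> k * V j k)" if "i < n" "j < m" for i j
    using svd that by (simp add: compact_svd_def)
  have scale: "(\<Sum>k<r. (\<sigma> k * f k)\<^sup>2) \<le> S * (\<Sum>k<r. (f k)\<^sup>2)" for f
    unfolding sum_distrib_left power_mult_distrib by (intro sum_mono mult_right_mono s) auto
  show "(\<Sum>i<n. (A i l)\<^sup>2) \<le> S * \<beta>" if l: "l < m" for l
  proof -
    have "(\<Sum>i<n. (A i l)\<^sup>2) = (\<Sum>i<n. (\<Sum>k<r. U i k * (\<sigma> k * V l k))\<^sup>2)"
      using A l by (simp add: mult.assoc)
    also have "\<dots> = (\<Sum>k<r. (\<sigma> k * V l k)\<^sup>2)"
      by (rule sum_square_orthonormal) (use svd in \<open>simp add: compact_svd_def\<close>)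
    also have "\<dots> \<le> S * (\<Sum>k<r. (V l k)\<^sup>2)" by (rule scale)
    also have "\<dots> \<le> S * \<beta>" by (intro mult_left_mono V l S0)
    finally show ?thesis .
  qed
  show "(\<Sum>l<m. (A i l)\<^sup>2) \<le> S * \<alpha>" if i: "i < n" for i
  proof -
    have "(\<Sum>l<m. (A i l)\<^sup>2) = (\<Sum>l<m. (\<Sum>k<r. V l k * (\<sigma> k * U i k))\<^sup>2)"
      using A i by (simp add: mult_ac)
    also have "\<dots> = (\<Sum>k<r. (\<sigma> k * U i k)\<^sup>2)"
      by (rule sum_square_orthonormal) (use svd in \<open>simp add: compact_svd_def\<close>)
    also have "\<dots> \<le> S * (\<Sum>k<r. (U i k)\<^sup>2)" by (rule scale)
    also have "\<dots> \<le> S * \<alpha>" by (intro mult_left_mono U i S0)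
    finally show ?thesis .
  qed
  show "(A i l)\<^sup>2 \<le> S * (\<alpha> * \<beta>)" if i: "i < n" and l: "l < m" for i l
  proof -
    have \<alpha>0: "0 \<le> \<alpha>" by (rule order_trans[OF _ U[OF i]]) (auto intro: sum_nonneg)
    have "(A i l)\<^sup>2 = (\<Sum>k<r. U i k * (\<sigma> k * V l k))\<^sup>2"
      using A i l by (simp add: mult.assoc)
    also have "\<dots> \<le> (\<Sum>k<r. (U i k)\<^sup>2) * (\<Sum>k<r. (\<sigma> k * V l k)\<^sup>2)"
      by (rule Cauchy_Schwarz_ineq_sum)
    also have "\<dots> \<le> \<alpha> * (S * \<beta>)"
      by (intro mult_mono U i \<alpha>0 sum_nonneg order_trans[OF scale] mult_left_mono V l S0) auto
    finally show ?thesis by (simp add: mult_ac)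
  qed
qed

text \<open>A unit column has a nonzero entry, so some row has positive norm. This makes the scale
  used below strictly positive.\<close>

lemma incoherence_pos:
  fixes U :: "nat \<Rightarrow> nat \<Rightarrow> real"
  assumes "(\<Sum>i<n. U i k * U i k) = 1" "k < r" "\<And>i. i < n \<Longrightarrow> (\<Sum>k<r. (U i k)\<^sup>2) \<le> \<alpha>"
  shows "0 < \<alpha>"
proof -
  obtain i where i: "i < n" "U i k \<noteq> 0"
    using assms(1) by (metis (no_types, lifting) lessThan_iff mult_eq_0_iff sum.neutral zero_neq_one)
  have "0 < (U i k)\<^sup>2" using i by simp
  also have "\<dots> \<le> (\<Sum>k<r. (U i k)\<^sup>2)"
    using assms(2) by (intro member_le_sum) auto
  also have "\<dots> \<le> \<alpha>" using assms(3) i by simp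
  finally show ?thesis .
qed

section \<open>Choice of the moment order and of the scale\<close>

text \<open>The least exponent works: its predecessor gives a power below \<open>z\<close>, and z >=
  2 forces the exponent to be positive.\<close>

lemma power_of_two_between:
  fixes z :: real
  assumes "2 \<le> z"
  obtains s where "z \<le> 2 ^ Suc s" "2 ^ Suc s \<le> 2 * z"
proof -
  define k where "k = (LEAST k. z \<le> 2 ^ k)"
  have "\<exists>k. z \<le> 2 ^ k" using real_arch_pow[of 2 z] by (auto intro: less_imp_le)
  then have k: "z \<le> 2 ^ k" unfolding k_def by (rule LeastI_ex)
  with assms have "k \<noteq> 0" by (cases k) auto
  then obtain s where s: "k = Suc s" by (cases k) auto
  have "\<not> z \<le> 2 ^ s" using not_less_Least[of s "\<lambda>k. z \<le> 2 ^ k"] s unfolding k_def by simp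
  then show thesis using that[of s] k s by simp
qed

text \<open>The generic case: positive rank makes \<open>A\<close> nonzero, and n >= 2 keeps ln n
  away from 0, so that the moment order \<open>N\<close> is comparable to a ln n.\<close>

lemma wedge_matrix_incoherent:
  fixes a p \<mu>1 \<mu>2 :: real
  assumes n: "n \<ge> 2" and m: "m \<ge> 1" and inc: "rank_r_incoherent n m r \<mu>1 \<mu>2 A"
    and p: "0 < p" "p \<le> 1" and a: "a > 2" and r: "r > 0"
  defines "X \<equiv> a * \<mu>1 * \<mu>2 * (real r)\<^sup>2 * ln (real n) / (p * real m * real n)"
  shows "1 - real n powr (- a) \<le> measure_pmf.prob (wedge_sampling n m p)
     {\<omega>. spec_norm n n (\<lambda>i j. wedge_matrix n m p A \<omega> i j - (\<Sum>l<m. A i l * A j l))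
           \<le> 12 * (sqrt X + X) * (spec_norm n m A)\<^sup>2}"
proof -
  define \<alpha> where "\<alpha> = \<mu>1 * real r / real n"
  define \<beta> where "\<beta> = \<mu>2 * real r / real m"
  obtain U \<sigma> V where svd: "compact_svd n m r A U \<sigma> V"
    and U: "\<And>i. i < n \<Longrightarrow> (\<Sum>k<r. (U i k)\<^sup>2) \<le> \<alpha>"
    and V: "\<And>j. j < m \<Longrightarrow> (\<Sum>k<r. (V j k)\<^sup>2) \<le> \<beta>"
    using inc unfolding rank_r_incoherent_def \<alpha>_def \<beta>_def by blast
  define S where "S = (spec_norm n m A)\<^sup>2"
  note bnd = incoherence_bounds[OF svd U V, folded S_def]
  have "0 < \<sigma> 0" using svd r by (simp add: compact_svd_def)
  then have S: "0 < S" using singular_value_le_spec_norm[OF svd r] unfolding S_def by simp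
  have \<alpha>: "0 < \<alpha>" by (rule incoherence_pos[of U 0 n r]) (use svd r U in \<open>auto simp: compact_svd_def\<close>)
  have \<beta>: "0 < \<beta>" by (rule incoherence_pos[of V 0 m r]) (use svd r V in \<open>auto simp: compact_svd_def\<close>)
  define T where "T = \<alpha> * \<beta> / p"
  have T: "0 < T" unfolding T_def using \<alpha> \<beta> p by simp
  \<comment> \<open>Chosen so that n e^(-z) = n^(-a), the extra 1 absorbing the dimension factor of
    the trace.\<close>
  define z where "z = (a + 1) * ln (real n)"
  have "ln 2 \<le> ln (real n)" using n by simp
  then have ln: "2 / 3 \<le> ln (real n)" using ln2_ge_two_thirds by linarith
  have "3 * (2 / 3) \<le> z" unfolding z_def using a ln by (intro mult_mono) auto
  then have z2: "2 \<le> z" by simp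
  \<comment> \<open>Uses 2 (a + 1) <= 3 a, which holds because a > 2.\<close>
  have z3: "2 * z \<le> 3 * (a * ln (real n))"
    unfolding z_def using a ln by (simp add: mult.assoc[symmetric] mult_right_mono)
  obtain s where s: "z \<le> 2 ^ Suc s" "2 ^ Suc s \<le> 2 * z" by (rule power_of_two_between[OF z2])
  define N :: nat where "N = 2 ^ Suc s"
  have Nz: "z \<le> real N" "real N \<le> 3 * (a * ln (real n))"
    using s z3 unfolding N_def by auto
  have XT: "X = a * ln (real n) * T"
    unfolding X_def T_def \<alpha>_def \<beta>_def by (simp add: power2_eq_square field_simps)
  have X0: "0 \<le> X" unfolding XT using a ln T by simp
  \<comment> \<open>\<open>t * h\<close> is the square root of T N. Naming the two roots keeps the
    estimates below rational in \<open>t\<close> and \<open>h\<close>.\<close>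
  define t where "t = sqrt T"
  define h where "h = sqrt (real N)"
  have t: "0 < t" "t\<^sup>2 = T" using T by (auto simp: t_def)
  have h: "0 < h" "h\<^sup>2 = real N" by (auto simp: h_def N_def)
  \<comment> \<open>Any \<open>\<tau>\<close> above the entry bound \<open>T * S\<close> is admissible; adding \<open>S * sqrt (T / N)\<close>
    balances the two terms of the moment bound.\<close>
  define \<tau> where "\<tau> = T * S + S * (t / h)"
  have \<tau>: "0 < \<tau>" unfolding \<tau>_def using T S t h by (intro add_pos_pos) auto
  have th: "t * h \<le> 2 * sqrt X" and th2: "(t * h)\<^sup>2 \<le> 3 * X"
  proof -
    have "(t * h)\<^sup>2 = T * real N" by (simp add: power_mult_distrib t h)
    also have "\<dots> \<le> T * (3 * (a * ln (real n)))" using Nz T by (intro mult_left_mono) auto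
    finally show th2: "(t * h)\<^sup>2 \<le> 3 * X" by (simp add: XT mult_ac)
    have "(2 * sqrt X)\<^sup>2 = 4 * X" using X0 by (simp add: power_mult_distrib)
    then have "(t * h)\<^sup>2 \<le> (2 * sqrt X)\<^sup>2" using th2 X0 by linarith
    then show "t * h \<le> 2 * sqrt X" by (rule power2_le_imp_le) (simp add: X0)
  qed
  have Q: "T * S\<^sup>2 / \<tau> + real N * \<tau> \<le> S * (2 * (t * h) + (t * h)\<^sup>2)"
  proof -
    \<comment> \<open>Dropping \<open>T * S\<close> from the denominator leaves exactly
      \<open>S * (t * h)\<close>; the term \<open>real N * \<tau>\<close> contributes a second copy
      and the quadratic term.\<close>
    have "T * S\<^sup>2 / \<tau> \<le> T * S\<^sup>2 / (S * (t / h))"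
      using T S t h \<tau> by (intro divide_left_mono mult_pos_pos) (auto simp: \<tau>_def)
    also have "\<dots> = S * (t * h)"
      using S t(1) h(1) by (simp add: t(2)[symmetric] power2_eq_square field_simps)
    finally have "T * S\<^sup>2 / \<tau> \<le> S * (t * h)" .
    moreover have "real N * \<tau> = S * (t * h)\<^sup>2 + S * (t * h)"
      unfolding \<tau>_def h(2)[symmetric] t(2)[symmetric] using h(1)
      by (simp add: power2_eq_square field_simps)
    ultimately show ?thesis by (simp add: algebra_simps)
  qed
  \<comment> \<open>The constant 12 is 3 * 4: e <= 3, 2 t h <= 4 sqrt X, and (t h)^2 <= 3 X is
    weakened to 4 X.\<close>
  have B: "exp 1 * (T * S\<^sup>2 / \<tau> + real N * \<tau>) \<le> 12 * (sqrt X + X) * S"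
  proof -
    have "exp 1 * (T * S\<^sup>2 / \<tau> + real N * \<tau>) \<le> 3 * (S * (2 * (t * h) + (t * h)\<^sup>2))"
      using exp_le T S \<tau> by (intro mult_mono Q) auto
    also have "\<dots> \<le> 3 * (S * (2 * (2 * sqrt X) + 4 * X))"
      using th th2 S X0 by (intro mult_left_mono add_mono) auto
    also have "\<dots> = 12 * (sqrt X + X) * S" by (simp add: algebra_simps)
    finally show ?thesis .
  qed
  have "1 - real n * exp (- real N) \<le> measure_pmf.prob (wedge_sampling n m p)
     {\<omega>. spec_norm n n (\<lambda>i j. wedge_matrix n m p A \<omega> i j - (\<Sum>l<m. A i l * A j l))
           \<le> 12 * (sqrt X + X) * S}"
  proof (rule wedge_matrix_concentration[OF p \<tau> _ _ _ N_def B])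
    fix i j l assume ijl: "i < n" "j < n" "l < m"
    have "(A i l * A j l)\<^sup>2 \<le> (S * (\<alpha> * \<beta>))\<^sup>2"
      unfolding power_mult_distrib[of "A i l"] power2_eq_square[of "S * (\<alpha> * \<beta>)"]
      by (intro mult_mono bnd ijl) (use S \<alpha> \<beta> in auto)
    then have "\<bar>A i l * A j l\<bar> \<le> S * (\<alpha> * \<beta>)"
      using S \<alpha> \<beta> by (intro power2_le_imp_le[of "\<bar>A i l * A j l\<bar>"]) auto
    then have "\<bar>A i l * A j l\<bar> / p \<le> T * S"
      unfolding T_def using p by (simp add: divide_right_mono mult_ac)
    also have "\<dots> \<le> \<tau>" unfolding \<tau>_def using S t h by simp
    finally show "\<bar>A i l * A j l\<bar> / p \<le> \<tau>" .
  next
    fix i assume i: "i < n"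
    \<comment> \<open>The row variance factors through the column norms: columns are bounded by
      \<open>S * \<beta>\<close> first, then the row by \<open>S * \<alpha>\<close>.\<close>
    have "(\<Sum>x<n. \<Sum>l<m. (A i l * A x l)\<^sup>2 / p) = (\<Sum>l<m. (A i l)\<^sup>2 * (\<Sum>x<n. (A x l)\<^sup>2)) / p"
      by (subst sum.swap) (simp add: sum_distrib_left sum_divide_distrib power_mult_distrib)
    also have "\<dots> \<le> (\<Sum>l<m. (A i l)\<^sup>2 * (S * \<beta>)) / p"
      using p by (intro divide_right_mono sum_mono mult_left_mono bnd) auto
    also have "\<dots> \<le> (S * \<alpha>) * (S * \<beta>) / p"
      unfolding sum_distrib_right[symmetric]
      using p S \<beta> by (intro divide_right_mono mult_right_mono bnd i) auto
    also have "\<dots> = T * S\<^sup>2" unfolding T_def by (simp add: power2_eq_square)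
    finally show "(\<Sum>x<n. \<Sum>l<m. (A i l * A x l)\<^sup>2 / p) \<le> T * S\<^sup>2" .
  qed (use T in simp)
  moreover have "real n * exp (- real N) \<le> real n powr (- a)"
  proof -
    have "real n * exp (- real N) \<le> real n * exp (- z)"
      using Nz by (intro mult_left_mono) auto
    also have "\<dots> = exp (ln (real n) + - z)"
      unfolding exp_add using n by simp
    also have "\<dots> = real n powr (- a)"
      using n by (simp add: z_def powr_def algebra_simps)
    finally show ?thesis .
  qed
  ultimately show ?thesis unfolding S_def by linarith
qed

lemma spec_norm_zero:
  assumes "\<And>i j. i < n \<Longrightarrow> j < m \<Longrightarrow> M i j = 0"
  shows "spec_norm n m M = 0"
proof -
  have "{x::nat \<Rightarrow> real. (\<Sum>j<m. (x j)\<^sup>2) \<le> 1} \<noteq> {}" by (auto intro!: exI[of _ "\<lambda>_. 0"])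
  then show ?thesis unfolding spec_norm_def using assms by simp
qed

theorem theorem3p1:
  "\<exists>C>0. \<exists>K>0. \<forall>(n::nat) (m::nat) (r::nat) (\<mu>1::real) (\<mu>2::real)
        (A::nat \<Rightarrow> nat \<Rightarrow> real) (p::real) (a::real).
      n \<ge> 1 \<and> m \<ge> 1 \<and> rank_r_incoherent n m r \<mu>1 \<mu>2 A \<and> 0 < p \<and> p \<le> 1 \<and> a > 2 \<longrightarrow>
      measure_pmf.prob (wedge_sampling n m p)
        {\<omega>. spec_norm n n (\<lambda>i j. wedge_matrix n m p A \<omega> i j - (\<Sum>l<m. A i l * A j l))
              \<le> C * (sqrt (a * \<mu>1 * \<mu>2 * (real r)\<^sup>2 * ln (real n) / (p * real m * real n))
                     + a * \<mu>1 * \<mu>2 * (real r)\<^sup>2 * ln (real n) / (p * real m * real n))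
                  * (spec_norm n m A)\<^sup>2}
      \<ge> 1 - K * real n powr (- a)"
proof (rule exI[of _ 12], intro conjI, simp, rule exI[of _ 1], intro conjI allI impI, simp)
  fix n m r :: nat and \<mu>1 \<mu>2 :: real and A :: "nat \<Rightarrow> nat \<Rightarrow> real" and p a :: real
  assume *: "n \<ge> 1 \<and> m \<ge> 1 \<and> rank_r_incoherent n m r \<mu>1 \<mu>2 A \<and> 0 < p \<and> p \<le> 1 \<and> a > 2"
  let ?X = "a * \<mu>1 * \<mu>2 * (real r)\<^sup>2 * ln (real n) / (p * real m * real n)"
  let ?G = "{\<omega>. spec_norm n n (\<lambda>i j. wedge_matrix n m p A \<omega> i j - (\<Sum>l<m. A i l * A j l))
              \<le> 12 * (sqrt ?X + ?X) * (spec_norm n m A)\<^sup>2}"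
  \<comment> \<open>For n = 1 the claimed lower bound is 1 - 1 = 0. For r = 0 both \<open>A\<close>
    and its wedge matrix vanish within the index bounds, so the event is everything.\<close>
  consider "n = 1" | "n \<ge> 2" "r = 0" | "n \<ge> 2" "r > 0" using * by linarith
  then show "1 - 1 * real n powr (- a) \<le> measure_pmf.prob (wedge_sampling n m p) ?G"
  proof cases
    case 1
    then show ?thesis by simp
  next
    case 2
    then have A: "A i j = 0" if "i < n" "j < m" for i j
      using * that by (auto simp: rank_r_incoherent_def compact_svd_def)
    have "spec_norm n n (\<lambda>i j. wedge_matrix n m p A \<omega> i j - (\<Sum>l<m. A i l * A j l)) = 0" for \<omega>
      by (rule spec_norm_zero) (auto simp: wedge_matrix_eq A intro!: sum.neutral)
    then have "?G = UNIV" using 2 by simp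
    then show ?thesis by simp
  next
    case 3
    then show ?thesis using wedge_matrix_incoherent[of n m r \<mu>1 \<mu>2 A p a] * by simp
  qed
qed

end
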